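(* Let $d\ge2$ be an integer and $l=2$. For every $0<\beta<1/d$, the Hessian matrix of $(\rho,\theta)\mapsto\Psi_{d,2}(\beta,\rho,\theta)$ is negative definite at every point of $\mathcal R_\beta$. Consequently, $(\rho,\theta)=(\beta^2,\,2(d-1)\beta^2)$ is the unique global maximizer of $\Psi_{d,2}(\beta,\cdot,\cdot)$ on $\mathcal R_\beta$.
   Context: For integers $d,l\ge2$ and $0<\beta<1/d$ (here used with $l=2$): $$\mathcal R_\beta:=\left\{(\rho,\theta):0<\rho<\beta,\ \max\left\{0,2l\beta-l\rho-\tfrac ld\right\}<\theta<l\beta-l\rho\right\},$$ and for $(\rho,\theta)\in\mathcal R_\beta$, $$\begin{aligned}\Psi_{d,l}(\beta,\rho,\theta)={}&-\rho\log\rho-\theta\log\tfrac\theta l+(l-1)(1-2\beta+\rho)\log(1-2\beta+\rho)+\theta\log(d-1)\\&+2(l-1)(\beta-\rho)\log(\beta-\rho)-2l\left(\beta-\rho-\tfrac\theta l\right)\log\left(\beta-\rho-\tfrac\theta l\right)\\&-\tfrac ld\left(1-2\beta d+\rho d+\tfrac{\theta d}l\right)\log\left(1-2\beta d+\rho d+\tfrac{\theta d}l\right).\end{aligned}$$ *)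

theory Defs
  imports "HOL-Analysis.Analysis"
begin

(* A point (\<rho>, \<theta>) of the plane is the vector x :: real^2 with x $ 1 = \<rho> and x $ 2 = \<theta>. *)

definition region :: "nat \<Rightarrow> nat \<Rightarrow> real \<Rightarrow> (real^2) set" where
  "region d l \<beta> = {x. 0 < x $ 1 \<and> x $ 1 < \<beta> \<and>
     max 0 (2 * real l * \<beta> - real l * (x $ 1) - real l / real d) < x $ 2 \<and>
     x $ 2 < real l * \<beta> - real l * (x $ 1)}"

definition Psi :: "nat \<Rightarrow> nat \<Rightarrow> real \<Rightarrow> real \<Rightarrow> real \<Rightarrow> real" where
  "Psi d l \<beta> \<rho> \<theta> =
     - \<rho> * ln \<rho> - \<theta> * ln (\<theta> / real l)
     + (real l - 1) * (1 - 2 * \<beta> + \<rho>) * ln (1 - 2 * \<beta> + \<rho>)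
     + \<theta> * ln (real d - 1)
     + 2 * (real l - 1) * (\<beta> - \<rho>) * ln (\<beta> - \<rho>)
     - 2 * real l * (\<beta> - \<rho> - \<theta> / real l) * ln (\<beta> - \<rho> - \<theta> / real l)
     - real l / real d * (1 - 2 * \<beta> * real d + \<rho> * real d + \<theta> * real d / real l)
         * ln (1 - 2 * \<beta> * real d + \<rho> * real d + \<theta> * real d / real l)"

(* f is twice (Frechet) differentiable at x with Hessian matrix H: f has a gradient g
   in a neighbourhood of x, and H is the Jacobian matrix of g at x.  A relation is used so
   that the existence of the derivatives is part of the claim; the two lemmas below show
   that H is unique and is the matrix of iterated partial derivatives. *)
definition has_hessian :: "(real^'n \<Rightarrow> real) \<Rightarrow> real^'n^'n \<Rightarrow> real^'n \<Rightarrow> bool" where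
  "has_hessian f H x \<longleftrightarrow>
     (\<exists>g. (\<forall>\<^sub>F y in nhds x. GDERIV f y :> g y) \<and> (g has_derivative (\<lambda>h. H *v h)) (at x))"

lemma has_hessian_partial:
  fixes f :: "real^'n \<Rightarrow> real"
  assumes "has_hessian f H x"
  shows "((\<lambda>t. deriv (\<lambda>s. f (x + t *\<^sub>R axis j 1 + s *\<^sub>R axis i 1)) 0)
            has_real_derivative H $ i $ j) (at 0)"
proof -
  from assms obtain g where g: "\<forall>\<^sub>F y in nhds x. GDERIV f y :> g y"
    and H: "(g has_derivative (\<lambda>h. H *v h)) (at x)"
    unfolding has_hessian_def by blast
  have first: "deriv (\<lambda>s. f (y + s *\<^sub>R axis i 1)) 0 = g y $ i" if y: "GDERIV f y :> g y" for y
  proof (rule DERIV_imp_deriv)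
    have "((\<lambda>s. y + s *\<^sub>R axis i 1) has_derivative (\<lambda>s. s *\<^sub>R axis i 1)) (at (0::real))"
      by (auto intro!: derivative_eq_intros)
    moreover have "(f has_derivative (\<lambda>h. inner h (g y))) (at (y + 0 *\<^sub>R axis i 1))"
      using y by (simp add: gderiv_def)
    ultimately have "((\<lambda>s. f (y + s *\<^sub>R axis i 1)) has_derivative
        (\<lambda>s. inner (s *\<^sub>R axis i 1) (g y))) (at 0)"
      by (rule has_derivative_compose)
    then show "((\<lambda>s. f (y + s *\<^sub>R axis i 1)) has_real_derivative g y $ i) (at 0)"
      by (simp add: has_field_derivative_def inner_axis' mult_commute_abs)
  qed
  have line: "((\<lambda>t. x + t *\<^sub>R axis j 1) has_derivative (\<lambda>t. t *\<^sub>R axis j 1)) (at (0::real))"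
    by (auto intro!: derivative_eq_intros)
  moreover have "((\<lambda>y. g y $ i) has_derivative (\<lambda>h. (H *v h) $ i)) (at (x + 0 *\<^sub>R axis j 1))"
    using bounded_linear.has_derivative[OF bounded_linear_vec_nth H] by simp
  ultimately have "((\<lambda>t. g (x + t *\<^sub>R axis j 1) $ i) has_derivative
      (\<lambda>t. (H *v (t *\<^sub>R axis j 1)) $ i)) (at 0)"
    by (rule has_derivative_compose)
  then have second: "((\<lambda>t. g (x + t *\<^sub>R axis j 1) $ i) has_real_derivative H $ i $ j) (at 0)"
    by (simp add: has_field_derivative_def matrix_vector_mult_scaleR matrix_vector_mul_component
        inner_axis mult_commute_abs)
  have "isCont (\<lambda>t. x + t *\<^sub>R axis j 1) (0::real)"
    using line by (rule has_derivative_continuous)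
  then have "filterlim (\<lambda>t. x + t *\<^sub>R axis j 1) (nhds x) (nhds (0::real))"
    using tendsto_at_iff_tendsto_nhds[of "\<lambda>t. x + t *\<^sub>R axis j 1" "0::real"]
    by (simp add: isCont_def)
  then have "\<forall>\<^sub>F t in nhds (0::real). GDERIV f (x + t *\<^sub>R axis j 1) :> g (x + t *\<^sub>R axis j 1)"
    using g by (rule eventually_compose_filterlim[rotated])
  then have "\<forall>\<^sub>F t in nhds (0::real).
      deriv (\<lambda>s. f (x + t *\<^sub>R axis j 1 + s *\<^sub>R axis i 1)) 0 = g (x + t *\<^sub>R axis j 1) $ i"
    by (rule eventually_mono) (rule first)
  then show ?thesis
    using second by (simp add: DERIV_cong_ev)
qed

lemma has_hessian_unique:
  assumes "has_hessian f H x" "has_hessian f H' x"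
  shows "H = H'"
  using DERIV_unique[OF has_hessian_partial[OF assms(1)] has_hessian_partial[OF assms(2)]]
  by (simp add: vec_eq_iff)

definition negative_definite :: "real^'n^'n \<Rightarrow> bool" where
  "negative_definite H \<longleftrightarrow> transpose H = H \<and> (\<forall>v. v \<noteq> 0 \<longrightarrow> inner v (H *v v) < 0)"

end

theory Submission
  imports Defs
begin

text \<open>
  In the coordinates \<open>\<rho>\<close> and \<open>u = \<theta> / 2\<close> the negative Hessian of \<open>\<Psi>\<close> in the direction \<open>(p, q)\<close> is
  \<open>a p\<^sup>2 + (2 / u) q\<^sup>2 + (4 / C + 2 d / D) (p + q)\<^sup>2\<close> with \<open>C = \<beta> - \<rho> - u\<close>,
  \<open>D = 1 - 2 \<beta> d + \<rho> d + u d\<close> and \<open>a = 1 / \<rho> - 1 / (1 - 2 \<beta> + \<rho>) - 2 / (u + C)\<close>.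
  The only negative contribution is that of \<open>- 2 / (u + C)\<close>, and it is absorbed by
  \<open>p\<^sup>2 / (u + C) \<le> q\<^sup>2 / u + (p + q)\<^sup>2 / C\<close> (Cauchy-Schwarz).  The gradient vanishes at
  \<open>(\<beta>\<^sup>2, 2 (d - 1) \<beta>\<^sup>2)\<close>, and a critical point of a function with negative definite
  Hessian on a convex set is its unique maximizer there.
\<close>

text \<open>Restrict \<open>f\<close> to the segment from \<open>p\<close> to \<open>y\<close> and
  apply the mean value theorem twice, first to \<open>f\<close> and then to its directional
  derivative, which vanishes at \<open>p\<close>. No compactness or boundary analysis
  enters.\<close>

lemma critical_point_unique_max:
  fixes f :: "'a::real_inner \<Rightarrow> real"
  assumes S: "convex S" "p \<in> S" "y \<in> S" "y \<noteq> p"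
    and f: "\<And>x. x \<in> S \<Longrightarrow> GDERIV f x :> g x"
    and g: "\<And>x. x \<in> S \<Longrightarrow> (g has_derivative g' x) (at x)"
    and neg: "\<And>x h. x \<in> S \<Longrightarrow> h \<noteq> 0 \<Longrightarrow> inner h (g' x h) < 0"
    and crit: "g p = 0"
  shows "f y < f p"
proof -
  define h where "h = y - p"
  have h: "h \<noteq> 0" using S by (simp add: h_def)
  have mem: "p + s *\<^sub>R h \<in> S" if "0 \<le> s" "s \<le> 1" for s
  proof -
    have "p + s *\<^sub>R h = (1 - s) *\<^sub>R p + s *\<^sub>R y"
      by (simp add: h_def algebra_simps)
    then show ?thesis using convexD_alt[OF S(1-3) that] by simp
  qed
  have line: "((\<lambda>s. p + s *\<^sub>R h) has_derivative (\<lambda>s. s *\<^sub>R h)) (at s)" for s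
    by (auto intro!: derivative_eq_intros)
  have d1: "((\<lambda>s. f (p + s *\<^sub>R h)) has_real_derivative inner h (g (p + s *\<^sub>R h))) (at s)"
    if "0 \<le> s" "s \<le> 1" for s
    using has_derivative_compose[OF line f[OF mem[OF that], unfolded gderiv_def]]
    by (simp add: has_field_derivative_def mult_commute_abs)
  have d2: "((\<lambda>s. inner h (g (p + s *\<^sub>R h))) has_real_derivative
      inner h (g' (p + s *\<^sub>R h) h)) (at s)" if "0 \<le> s" "s \<le> 1" for s
  proof -
    have "linear (g' (p + s *\<^sub>R h))"
      using g[OF mem[OF that]] by (rule has_derivative_linear)
    then show ?thesis
      using has_derivative_inner_right[OF has_derivative_compose[OF line g[OF mem[OF that]]], of h]
      by (simp add: has_field_derivative_def mult_commute_abs linear_cmul)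
  qed
  obtain s where s: "0 < s" "s < 1"
    and 1: "f (p + 1 *\<^sub>R h) - f (p + 0 *\<^sub>R h) = (1 - 0) * inner h (g (p + s *\<^sub>R h))"
    using MVT2[of 0 1 "\<lambda>s. f (p + s *\<^sub>R h)" "\<lambda>s. inner h (g (p + s *\<^sub>R h))"] d1 by auto
  obtain r where r: "0 < r" "r < s"
    and 2: "inner h (g (p + s *\<^sub>R h)) - inner h (g (p + 0 *\<^sub>R h))
        = (s - 0) * inner h (g' (p + r *\<^sub>R h) h)"
    using MVT2[of 0 s "\<lambda>s. inner h (g (p + s *\<^sub>R h))" "\<lambda>s. inner h (g' (p + s *\<^sub>R h) h)"] d2 s
    by auto
  have "inner h (g (p + s *\<^sub>R h)) < 0"
    using 2 neg[OF mem h, of r] r s by (simp add: crit mult_pos_neg)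
  with 1 show ?thesis by (simp add: h_def)
qed

text \<open>Cauchy-Schwarz in fractional form: the difference of the two sides is a square over a
  positive number.\<close>

lemma sq_sum_div_le:
  fixes x y a b :: real
  assumes "0 < a" "0 < b"
  shows "(x + y)\<^sup>2 / (a + b) \<le> x\<^sup>2 / a + y\<^sup>2 / b"
proof -
  have "x\<^sup>2 / a + y\<^sup>2 / b - (x + y)\<^sup>2 / (a + b) = (x * b - y * a)\<^sup>2 / (a * b * (a + b))"
    using assms by (simp add: divide_simps power2_eq_square add_pos_pos) (simp add: algebra_simps)
  also have "\<dots> \<ge> 0" using assms by simp
  finally show ?thesis by simp
qed

lemma has_derivative_mult_ln:
  fixes f :: "'a::real_normed_vector \<Rightarrow> real"
  assumes "(f has_derivative f') (at x)" "0 < f x"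
  shows "((\<lambda>x. f x * ln (f x)) has_derivative (\<lambda>h. f' h * (ln (f x) + 1))) (at x)"
  using assms by (auto intro!: derivative_eq_intros simp: field_simps)

lemma has_derivative_real2:
  fixes f g :: "'a::real_normed_vector \<Rightarrow> real"
  assumes "(f has_derivative f') F" "(g has_derivative g') F"
  shows "((\<lambda>x. vector [f x, g x] :: real^2) has_derivative (\<lambda>h. vector [f' h, g' h])) F"
proof -
  have eq: "(vector [a, b] :: real^2) = a *\<^sub>R axis 1 1 + b *\<^sub>R axis 2 1" for a b :: real
    by (simp add: vec_eq_iff forall_2 axis_def)
  show ?thesis unfolding eq
    by (intro has_derivative_add has_derivative_scaleR_left assms)
qed

lemma convex_region: "convex (region d l \<beta>)"
proof -
  \<comment> \<open>The \<open>max\<close> splits into two lower bounds, which leaves five open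
    half-planes.\<close>
  have "region d l \<beta> =
      {x. inner (axis 1 1) x > 0} \<inter> {x. inner (axis 1 1) x < \<beta>} \<inter> {x. inner (axis 2 1) x > 0}
      \<inter> {x. inner (real l *\<^sub>R axis 1 1 + axis 2 1) x > 2 * real l * \<beta> - real l / real d}
      \<inter> {x. inner (real l *\<^sub>R axis 1 1 + axis 2 1) x < real l * \<beta>}"
    by (auto simp: region_def inner_add_left inner_axis' algebra_simps)
  then show ?thesis
    by (auto intro!: convex_Int convex_halfspace_lt convex_halfspace_gt)
qed

lemma open_region: "open (region d l \<beta>)"
  unfolding region_def
  by (intro open_Collect_conj open_Collect_less continuous_intros)

context
  fixes d :: nat and \<beta> :: real
  assumes d: "d \<ge> 2" and \<beta>: "0 < \<beta>" "\<beta> < 1 / real d"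
begin

text \<open>The constants from differentiating t ln t cancel in both coordinates: -1 + 1 - 2 + 4 - 2
  = 0 and -1 + 2 - 1 = 0.\<close>

definition grad_Psi :: "real^2 \<Rightarrow> real^2" where
  "grad_Psi x = vector
    [- ln (x $ 1) + ln (1 - 2 * \<beta> + x $ 1) - 2 * ln (\<beta> - x $ 1)
       + 4 * ln (\<beta> - x $ 1 - x $ 2 / 2)
       - 2 * ln (1 - 2 * \<beta> * real d + x $ 1 * real d + x $ 2 * real d / 2),
     - ln (x $ 2 / 2) + ln (real d - 1) + 2 * ln (\<beta> - x $ 1 - x $ 2 / 2)
       - ln (1 - 2 * \<beta> * real d + x $ 1 * real d + x $ 2 * real d / 2)]"

text \<open>The terms collected in \<open>k\<close> depend only on \<rho> + \<theta> / 2, hence the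
  rank-one pattern \<open>k\<close>, \<open>k / 2\<close>, \<open>k / 4\<close>.\<close>

definition hess_Psi :: "real^2 \<Rightarrow> real^2^2" where
  "hess_Psi x =
    (let k = 4 / (\<beta> - x $ 1 - x $ 2 / 2)
           + 2 * real d / (1 - 2 * \<beta> * real d + x $ 1 * real d + x $ 2 * real d / 2);
         a = 1 / x $ 1 - 1 / (1 - 2 * \<beta> + x $ 1) - 2 / (\<beta> - x $ 1)
     in vector [vector [- a - k, - k / 2], vector [- k / 2, - 1 / x $ 2 - k / 4]])"

lemma two_beta: "2 * \<beta> < 1"
proof -
  have "1 / real d \<le> 1 / 2" using d by (simp add: divide_simps)
  with \<beta> show ?thesis by linarith
qed

text \<open>These quantities are, up to a factor 2, the arguments of the logarithms in the gradient
  and the denominators in the Hessian.\<close>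

lemma region_pos:
  assumes "x \<in> region d 2 \<beta>"
  shows "0 < x $ 1" "0 < x $ 2" "0 < \<beta> - x $ 1" "0 < 1 - 2 * \<beta> + x $ 1"
    "0 < \<beta> - x $ 1 - x $ 2 / 2"
    "0 < 1 - 2 * \<beta> * real d + x $ 1 * real d + x $ 2 * real d / 2"
proof -
  have "4 * \<beta> - 2 * x $ 1 - 2 / real d < x $ 2"
    using assms by (simp add: region_def)
  \<comment> \<open>Scaled by d / 2, the lower bound on \<theta> says exactly that the last
    logarithm has a positive argument.\<close>
  then have "(4 * \<beta> - 2 * x $ 1 - 2 / real d) * (real d / 2) < x $ 2 * (real d / 2)"
    using d by (intro mult_strict_right_mono) auto
  then show "0 < 1 - 2 * \<beta> * real d + x $ 1 * real d + x $ 2 * real d / 2"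
    using d by (simp add: algebra_simps)
qed (use assms two_beta in \<open>auto simp: region_def\<close>)

lemma GDERIV_Psi:
  assumes "x \<in> region d 2 \<beta>"
  shows "GDERIV (\<lambda>y. Psi d 2 \<beta> (y $ 1) (y $ 2)) x :> grad_Psi x"
proof -
  note pos = region_pos[OF assms]
  note nth = bounded_linear.has_derivative[OF bounded_linear_vec_nth]
  \<comment> \<open>Regrouped into terms f ln f with f affine, so that
    \<open>has_derivative_mult_ln\<close> applies to each.\<close>
  have Psi: "Psi d 2 \<beta> r t = - (r * ln r) - 2 * (t / 2 * ln (t / 2))
      + (1 - 2 * \<beta> + r) * ln (1 - 2 * \<beta> + r) + t * ln (real d - 1)
      + 2 * ((\<beta> - r) * ln (\<beta> - r)) - 4 * ((\<beta> - r - t / 2) * ln (\<beta> - r - t / 2))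
      - 2 / real d * ((1 - 2 * \<beta> * real d + r * real d + t * real d / 2)
        * ln (1 - 2 * \<beta> * real d + r * real d + t * real d / 2))" for r t
    by (simp add: Psi_def algebra_simps add_divide_distrib diff_divide_distrib)
  have "((\<lambda>y. Psi d 2 \<beta> (y $ 1) (y $ 2)) has_derivative (\<lambda>h. inner h (grad_Psi x))) (at x)"
    unfolding Psi
    apply (rule has_derivative_eq_rhs)
    apply (rule has_derivative_mult_ln | rule derivative_intros nth pos | simp add: pos)+
    apply (rule ext)
    using d by (simp add: inner_vec_def sum_2 grad_Psi_def field_simps)
  then show ?thesis by (simp add: gderiv_def)
qed

lemma has_derivative_grad_Psi:
  assumes "x \<in> region d 2 \<beta>"
  shows "(grad_Psi has_derivative (\<lambda>h. hess_Psi x *v h)) (at x)"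
proof -
  note pos = region_pos[OF assms]
  note nth = bounded_linear.has_derivative[OF bounded_linear_vec_nth]
  define C D where "C = \<beta> - x $ 1 - x $ 2 / 2"
    and "D = 1 - 2 * \<beta> * real d + x $ 1 * real d + x $ 2 * real d / 2"
  show ?thesis
    unfolding grad_Psi_def
    apply (rule has_derivative_eq_rhs)
    apply (rule has_derivative_real2)
    apply (rule derivative_eq_intros has_derivative_ln nth refl pos | simp add: pos)+
    apply (rule ext)
    unfolding hess_Psi_def Let_def C_def[symmetric] D_def[symmetric]
    by (simp add: vec_eq_iff forall_2 matrix_vector_mult_def sum_2
        inverse_eq_divide add_divide_distrib diff_divide_distrib algebra_simps)
qed

lemma negative_definite_hess_Psi:
  assumes "x \<in> region d 2 \<beta>"
  shows "negative_definite (hess_Psi x)"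
proof -
  note pos = region_pos[OF assms]
  \<comment> \<open>This \<open>a\<close> omits the negative term - 2 / (\<beta> - \<rho>), so it is
    positive; \<open>form\<close> displays that term separately.\<close>
  define u C D a where "u = x $ 2 / 2" and "C = \<beta> - x $ 1 - x $ 2 / 2"
    and "D = 1 - 2 * \<beta> * real d + x $ 1 * real d + x $ 2 * real d / 2"
    and "a = 1 / x $ 1 - 1 / (1 - 2 * \<beta> + x $ 1)"
  have u: "0 < u" and C: "0 < C" and D: "0 < 2 * real d / D" and uC: "\<beta> - x $ 1 = u + C"
    using pos d by (auto simp: u_def C_def D_def)
  have a: "0 < a"
    using pos two_beta by (simp add: a_def frac_less2)
  have form: "inner v (hess_Psi x *v v) =
      - (a - 2 / (u + C)) * p\<^sup>2 - 2 / u * q\<^sup>2 - (4 / C + 2 * real d / D) * (p + q)\<^sup>2"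
    if "p = v $ 1" "q = v $ 2 / 2" for v p q
  proof -
    have "x $ 2 = 2 * u" "v $ 2 = 2 * q" by (simp_all add: u_def that)
    then show ?thesis
      unfolding hess_Psi_def Let_def a_def[symmetric] C_def[symmetric] D_def[symmetric] uC
      by (simp add: inner_vec_def matrix_vector_mult_def sum_2 flip: that)
        (simp add: power2_eq_square algebra_simps add_divide_distrib diff_divide_distrib)
  qed
  have "inner v (hess_Psi x *v v) < 0" if "v \<noteq> 0" for v
  proof -
    define p q where "p = v $ 1" and "q = v $ 2 / 2"
    have "p \<noteq> 0 \<or> p + q \<noteq> 0"
      using that by (auto simp: p_def q_def vec_eq_iff forall_2)
    \<comment> \<open>Splitting p as (p + q) + (-q) and doubling uses up all of \<open>2 / u\<close>
      but only half of \<open>4 / C\<close>; the other half and \<open>a\<close> give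
      strictness.\<close>
    have "(p + q + - q)\<^sup>2 / (C + u) \<le> (p + q)\<^sup>2 / C + (- q)\<^sup>2 / u"
      using C u by (rule sq_sum_div_le)
    then have "2 / (u + C) * p\<^sup>2 \<le> 2 / C * (p + q)\<^sup>2 + 2 / u * q\<^sup>2"
      by (simp add: add.commute)
    moreover have "0 < a * p\<^sup>2 + 2 / C * (p + q)\<^sup>2"
    proof (cases "p = 0")
      case True
      with \<open>p \<noteq> 0 \<or> p + q \<noteq> 0\<close> C show ?thesis by simp
    next
      case False
      then show ?thesis using a C by (intro add_pos_nonneg mult_pos_pos) auto
    qed
    moreover have "0 \<le> 2 * real d / D * (p + q)\<^sup>2"
      using D by (intro mult_nonneg_nonneg) auto
    ultimately have "- (a - 2 / (u + C)) * p\<^sup>2 - 2 / u * q\<^sup>2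
        - (4 / C + 2 * real d / D) * (p + q)\<^sup>2 < 0"
      by (simp add: algebra_simps)
    then show ?thesis using form[OF p_def q_def] by simp
  qed
  moreover have "transpose (hess_Psi x) = hess_Psi x"
    by (simp add: hess_Psi_def Let_def transpose_def vec_eq_iff forall_2)
  ultimately show ?thesis by (simp add: negative_definite_def)
qed

lemma critical_point:
  defines "p \<equiv> vector [\<beta>\<^sup>2, 2 * (real d - 1) * \<beta>\<^sup>2] :: real^2"
  shows "p \<in> region d 2 \<beta>" "grad_Psi p = 0"
proof -
  have \<beta>d: "\<beta> * real d < 1" using \<beta> d by (simp add: field_simps)
  have \<beta>1: "\<beta> < 1" using two_beta \<beta> by simp
  have "real d > 1" using d by simp
  \<comment> \<open>At \<open>p\<close> every logarithm has an argument that factors into powers of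
    \<beta>, 1 - \<beta>, 1 - \<beta> d and d - 1, so the gradient becomes a linear combination of
    four logarithms and cancels.\<close>
  have A: "1 - 2 * \<beta> + \<beta>\<^sup>2 = (1 - \<beta>)\<^sup>2"
    and B: "\<beta> - \<beta>\<^sup>2 = \<beta> * (1 - \<beta>)"
    and C: "\<beta> - \<beta>\<^sup>2 - 2 * (real d - 1) * \<beta>\<^sup>2 / 2 = \<beta> * (1 - \<beta> * real d)"
    and D: "1 - 2 * \<beta> * real d + \<beta>\<^sup>2 * real d + 2 * (real d - 1) * \<beta>\<^sup>2 * real d / 2
      = (1 - \<beta> * real d)\<^sup>2"
    and U: "2 * (real d - 1) * \<beta>\<^sup>2 / 2 = (real d - 1) * \<beta>\<^sup>2"
    by (simp_all add: power2_eq_square field_simps)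
  \<comment> \<open>By \<open>D\<close>, this is the gap between \<theta> at \<open>p\<close> and
    its lower bound.\<close>
  have "0 < (1 - \<beta> * real d)\<^sup>2 * (2 / real d)" using \<beta>d d by simp
  also have "\<dots> = 2 * (real d - 1) * \<beta>\<^sup>2 - (4 * \<beta> - 2 * \<beta>\<^sup>2 - 2 / real d)"
    using d by (simp add: field_simps power2_eq_square)
  finally have "4 * \<beta> - 2 * \<beta>\<^sup>2 - 2 / real d < 2 * (real d - 1) * \<beta>\<^sup>2" by simp
  moreover have "0 < \<beta> * (1 - \<beta>)" "0 < \<beta> * (1 - \<beta> * real d)" using \<beta> \<beta>1 \<beta>d by simp_all
  then have "\<beta>\<^sup>2 < \<beta>" "2 * (real d - 1) * \<beta>\<^sup>2 < 2 * \<beta> - 2 * \<beta>\<^sup>2"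
    using B C by linarith+
  ultimately show "p \<in> region d 2 \<beta>"
    using \<beta> \<open>real d > 1\<close> by (simp add: p_def region_def)
  show "grad_Psi p = 0"
    \<comment> \<open>\<open>C\<close> has to be rewritten before \<open>B\<close> and
      \<open>U\<close>, whose left sides occur inside its own.\<close>
    unfolding p_def grad_Psi_def vector_2 C D unfolding A B U
    using \<beta> \<beta>1 \<beta>d \<open>real d > 1\<close> by (simp add: vec_eq_iff forall_2 ln_mult ln_realpow)
qed

end

theorem lemma3p8:
  fixes d :: nat and \<beta> :: real
  assumes "d \<ge> 2" and "0 < \<beta>" and "\<beta> < 1 / real d"
  shows "(\<forall>x \<in> region d 2 \<beta>. \<exists>H.
            has_hessian (\<lambda>y. Psi d 2 \<beta> (y $ 1) (y $ 2)) H x \<and> negative_definite H) \<and>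
         (\<forall>x. is_arg_max (\<lambda>y. Psi d 2 \<beta> (y $ 1) (y $ 2)) (\<lambda>y. y \<in> region d 2 \<beta>) x \<longleftrightarrow>
            x = vector [\<beta>^2, 2 * (real d - 1) * \<beta>^2])"
proof -
  let ?f = "\<lambda>y. Psi d 2 \<beta> (y $ 1) (y $ 2)" and ?R = "region d 2 \<beta>"
  let ?p = "vector [\<beta>^2, 2 * (real d - 1) * \<beta>^2] :: real^2"
  note crit = critical_point[OF assms]
  \<comment> \<open>Openness of the region supplies the neighbourhood of \<open>x\<close> on which
    the gradient formula holds.\<close>
  have hess: "has_hessian ?f (hess_Psi d \<beta> x) x" if "x \<in> ?R" for x
    unfolding has_hessian_def
    using eventually_nhds_in_open[OF open_region that]
      GDERIV_Psi[OF assms] has_derivative_grad_Psi[OF assms that]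
    by (blast intro: eventually_mono)
  have max: "?f y < ?f ?p" if "y \<in> ?R" "y \<noteq> ?p" for y
    by (rule critical_point_unique_max[OF convex_region crit(1) that
          GDERIV_Psi[OF assms] has_derivative_grad_Psi[OF assms] _ crit(2)])
      (use negative_definite_hess_Psi[OF assms] in \<open>auto simp: negative_definite_def\<close>)
  have "is_arg_max ?f (\<lambda>y. y \<in> ?R) x \<longleftrightarrow> x = ?p" for x
    using max crit(1) unfolding is_arg_max_def by (metis less_irrefl less_asym)
  with hess negative_definite_hess_Psi[OF assms] show ?thesis by blast
qed

end
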